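(* Consider a problem class with cardinality bounds satisfying $\underline p(n)=\bar p(n)>0$ for all $n\in\mathbb N$ and with cost bounds $0<m_\infty\le M_\infty$. Let $\varepsilon>0$ and let $k=qn$ be an integer with $$q\in\left[\frac{\frac{M_\infty}{m_\infty}}{\varepsilon+\frac{M_\infty}{m_\infty}},\,1\right].$$ If the parameters $\frac{M_\infty}{m_\infty}$ and $\varepsilon$ are fixed, then the min-max-min robust problem $(\mathrm M^3(k))$ can be approximated with a multiplicative error of $1+\varepsilon$ (i.e. a feasible solution with objective value at most $(1+\varepsilon)\,\mathrm{opt}(k)$ can be calculated) in oracle-polynomial time in $n$.
   Context: Notation: $\mathbb N=\{1,2,\dots\}$, $[k]=\{1,\dots,k\}$, $\mathbb R_+^n=\{x\in\mathbb R^n: x\ge 0\}$, and $\|x\|_0$ is the number of non-zero entries of $x$. An instance of dimension $n$ consists of a nonempty set $X\subseteq\{0,1\}^n$ and a nonempty convex set $U\subseteq\mathbb R_+^n$; all minima and maxima written are understood to be attained (e.g. $U$ compact). For $k\in\mathbb N$ the min-max-min robust problem $(\mathrm M^3(k))$ is $$\min_{x^{(1)},\dots,x^{(k)}\in X}\ \max_{c\in U}\ \min_{i=1,\dots,k} c^\top x^{(i)},$$ and $\mathrm{opt}(k)$ denotes its optimal value. A problem class has cardinality bounds $\underline p,\bar p:\mathbb N\to\mathbb R_+$ if for every instance of dimension $n$ in the class $\underline p(n)\le\|x\|_0\le\bar p(n)$ for all $x\in X$. Cost bounds $0<m_\infty\le M_\infty$ means that $m_\infty\le c_j\le M_\infty$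 for all $c\in U$ and all $j\in[n]$. Computational model: an oracle returns, for each cost vector $c\in U$, an optimal solution of $\min_{x\in X}c^\top x$ in constant time. Linear functions can be maximized over $U$ in polynomial time. As known from earlier work, $(\mathrm M^3(n))$ can then be solved in oracle-polynomial time. Moreover, for given points $x^1,\dots,x^n\in X$, an optimal $\lambda$ for $\min\{\max_{c\in U}c^\top x: x=\sum_i\lambda_ix^i,\ \sum_i\lambda_i=1,\ \lambda\ge0\}$ can be computed in polynomial time. Oracle-polynomial means polynomial when each oracle call is counted as constant time. *)

theory Defs
  imports
    "Jordan_Normal_Form.Matrix"
    "HOL-Computational_Algebra.Polynomial"
    "HOL-Library.Log_Nat"
begin

section \<open>Computational model\<close>

text \<open>
  Programs are while programs that may query oracles. They work on binary trees whose leaves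
  carry integers. Trees are shared, so that assignments, pairing and projections have unit cost;
  arithmetic and comparisons are charged the number of bits of their operands. Up to polynomial
  factors, running time is therefore that of a Turing machine. Oracles answer in one step.
\<close>

datatype val = Atom int | Node val val

fun atom_of :: "val \<Rightarrow> int" where
  "atom_of (Atom i) = i"
| "atom_of (Node _ _) = 0"

fun left :: "val \<Rightarrow> val" where
  "left (Node a _) = a"
| "left (Atom _) = Atom 0"

fun right :: "val \<Rightarrow> val" where
  "right (Node _ b) = b"
| "right (Atom _) = Atom 0"

definition int_len :: "int \<Rightarrow> nat" where
  "int_len i = 1 + nat (bitlen \<bar>i\<bar>)"

primrec val_len :: "val \<Rightarrow> nat" where
  "val_len (Atom i) = int_len i"
| "val_len (Node a b) = 1 + val_len a + val_len b"

type_synonym oracle_fun = "val \<Rightarrow> val"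
type_synonym store = "nat \<Rightarrow> val"

datatype exp =
    Var nat
  | Const int
  | Mk exp exp
  | Lft exp
  | Rgt exp
  | IsNode exp
  | Add exp exp
  | Sub exp exp
  | Mul exp exp
  | Leq exp exp

definition truth :: "bool \<Rightarrow> val" where
  "truth b = Atom (if b then 1 else 0)"

primrec eval_exp :: "exp \<Rightarrow> store \<Rightarrow> val" where
  "eval_exp (Var x) s = s x"
| "eval_exp (Const i) s = Atom i"
| "eval_exp (Mk a b) s = Node (eval_exp a s) (eval_exp b s)"
| "eval_exp (Lft a) s = left (eval_exp a s)"
| "eval_exp (Rgt a) s = right (eval_exp a s)"
| "eval_exp (IsNode a) s = truth (\<exists>u v. eval_exp a s = Node u v)"
| "eval_exp (Add a b) s = Atom (atom_of (eval_exp a s) + atom_of (eval_exp b s))"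
| "eval_exp (Sub a b) s = Atom (atom_of (eval_exp a s) - atom_of (eval_exp b s))"
| "eval_exp (Mul a b) s = Atom (atom_of (eval_exp a s) * atom_of (eval_exp b s))"
| "eval_exp (Leq a b) s = truth (atom_of (eval_exp a s) \<le> atom_of (eval_exp b s))"

definition arith_cost :: "val \<Rightarrow> val \<Rightarrow> nat" where
  "arith_cost u v = int_len (atom_of u) + int_len (atom_of v)"

primrec cost_exp :: "exp \<Rightarrow> store \<Rightarrow> nat" where
  "cost_exp (Var x) s = 1"
| "cost_exp (Const i) s = int_len i"
| "cost_exp (Mk a b) s = 1 + cost_exp a s + cost_exp b s"
| "cost_exp (Lft a) s = 1 + cost_exp a s"
| "cost_exp (Rgt a) s = 1 + cost_exp a s"
| "cost_exp (IsNode a) s = 1 + cost_exp a s"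
| "cost_exp (Add a b) s = cost_exp a s + cost_exp b s + arith_cost (eval_exp a s) (eval_exp b s)"
| "cost_exp (Sub a b) s = cost_exp a s + cost_exp b s + arith_cost (eval_exp a s) (eval_exp b s)"
| "cost_exp (Mul a b) s = cost_exp a s + cost_exp b s + arith_cost (eval_exp a s) (eval_exp b s)"
| "cost_exp (Leq a b) s = cost_exp a s + cost_exp b s + arith_cost (eval_exp a s) (eval_exp b s)"

text \<open>
  A condition is true iff its value differs from \<open>Atom 0\<close>. \<open>Call x c e\<close> runs \<open>c\<close> as a
  (non-recursive) procedure on a fresh store; variable 0 holds the argument and the result.
\<close>

datatype com =
    Skip
  | Assign nat exp
  | Seq com com
  | Cond exp com com
  | While exp com
  | Call nat com exp
  | Oracle nat exp

primrec oracle_free :: "com \<Rightarrow> bool" where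
  "oracle_free Skip \<longleftrightarrow> True"
| "oracle_free (Assign x e) \<longleftrightarrow> True"
| "oracle_free (Seq c d) \<longleftrightarrow> oracle_free c \<and> oracle_free d"
| "oracle_free (Cond e c d) \<longleftrightarrow> oracle_free c \<and> oracle_free d"
| "oracle_free (While e c) \<longleftrightarrow> oracle_free c"
| "oracle_free (Call x c e) \<longleftrightarrow> oracle_free c"
| "oracle_free (Oracle x e) \<longleftrightarrow> False"

definition init_store :: "val \<Rightarrow> store" where
  "init_store v = (\<lambda>_. Atom 0)(0 := v)"

inductive exec :: "oracle_fun \<Rightarrow> com \<Rightarrow> store \<Rightarrow> nat \<Rightarrow> store \<Rightarrow> bool" for orc where
  Skip: "exec orc Skip s 1 s"
| Assign: "exec orc (Assign x e) s (1 + cost_exp e s) (s(x := eval_exp e s))"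
| Seq: "exec orc c s t s' \<Longrightarrow> exec orc d s' t' s'' \<Longrightarrow> exec orc (Seq c d) s (t + t') s''"
| CondTrue: "eval_exp e s \<noteq> Atom 0 \<Longrightarrow> exec orc c s t s' \<Longrightarrow>
    exec orc (Cond e c d) s (1 + cost_exp e s + t) s'"
| CondFalse: "eval_exp e s = Atom 0 \<Longrightarrow> exec orc d s t s' \<Longrightarrow>
    exec orc (Cond e c d) s (1 + cost_exp e s + t) s'"
| WhileTrue: "eval_exp e s \<noteq> Atom 0 \<Longrightarrow> exec orc c s t s' \<Longrightarrow> exec orc (While e c) s' t' s'' \<Longrightarrow>
    exec orc (While e c) s (1 + cost_exp e s + t + t') s''"
| WhileFalse: "eval_exp e s = Atom 0 \<Longrightarrow> exec orc (While e c) s (1 + cost_exp e s) s"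
| Call: "exec orc c (init_store (eval_exp e s)) t s' \<Longrightarrow>
    exec orc (Call x c e) s (1 + cost_exp e s + t) (s(x := s' 0))"
| Oracle: "exec orc (Oracle x e) s (1 + cost_exp e s) (s(x := orc (eval_exp e s)))"

inductive_cases exec_SkipE: "exec orc Skip s t s'"
inductive_cases exec_AssignE: "exec orc (Assign x e) s t s'"
inductive_cases exec_SeqE: "exec orc (Seq c d) s t s'"
inductive_cases exec_CondE: "exec orc (Cond e c d) s t s'"
inductive_cases exec_WhileE: "exec orc (While e c) s t s'"
inductive_cases exec_CallE: "exec orc (Call x c e) s t s'"
inductive_cases exec_OracleE: "exec orc (Oracle x e) s t s'"

lemma exec_deterministic:
  "exec orc c s t s' \<Longrightarrow> exec orc c s u s'' \<Longrightarrow> u = t \<and> s'' = s'"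
proof (induction arbitrary: u s'' rule: exec.induct)
  case (Seq c s t s' d t' s2)
  from Seq.prems obtain t1 t2 s1 where "exec orc c s t1 s1" "exec orc d s1 t2 s''" "u = t1 + t2"
    by (rule exec_SeqE)
  with Seq.IH show ?case by blast
next
  case (CondTrue e s c t s' d)
  from CondTrue.prems CondTrue.hyps obtain t1 where "exec orc c s t1 s''" "u = 1 + cost_exp e s + t1"
    by (auto elim: exec_CondE)
  with CondTrue.IH show ?case by blast
next
  case (CondFalse e s d t s' c)
  from CondFalse.prems CondFalse.hyps obtain t1 where "exec orc d s t1 s''" "u = 1 + cost_exp e s + t1"
    by (auto elim: exec_CondE)
  with CondFalse.IH show ?case by blast
next
  case (WhileTrue e s c t s' t' s2)
  from WhileTrue.prems WhileTrue.hyps obtain t1 t2 s1 where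
    "exec orc c s t1 s1" "exec orc (While e c) s1 t2 s''" "u = 1 + cost_exp e s + t1 + t2"
    by (auto elim: exec_WhileE)
  with WhileTrue.IH show ?case by blast
next
  case (Call c e s t s' x)
  from Call.prems obtain t1 s1 where "exec orc c (init_store (eval_exp e s)) t1 s1"
    "u = 1 + cost_exp e s + t1" "s'' = s(x := s1 0)"
    by (elim exec_CallE) (rule that, simp_all)
  with Call.IH show ?case by blast
next
  case (WhileFalse e s c)
  then show ?case by (auto elim: exec_WhileE)
qed (auto elim: exec_SkipE exec_AssignE exec_OracleE)

text \<open>Time \<open>t\<close> includes the time needed to write down the output \<open>w\<close>.\<close>

definition runs :: "oracle_fun \<Rightarrow> com \<Rightarrow> val \<Rightarrow> val \<Rightarrow> nat \<Rightarrow> bool" where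
  "runs orc c v w t \<longleftrightarrow>
     (\<exists>t' s. exec orc c (init_store v) t' s \<and> w = s 0 \<and> t = t' + val_len w)"

text \<open>
  A computational problem is a set of tuples (size, input, admissible oracles, correct outputs);
  a single program has to work for all of them.
\<close>

definition solvable_in_oracle_poly_time :: "(nat \<times> val \<times> oracle_fun set \<times> val set) set \<Rightarrow> bool" where
  "solvable_in_oracle_poly_time P \<longleftrightarrow>
     (\<exists>c. \<exists>p :: nat poly. \<forall>(N, v, Orc, Out) \<in> P. \<forall>orc \<in> Orc.
        \<exists>w t. runs orc c v w t \<and> w \<in> Out \<and> t \<le> poly p N)"

definition solvable_in_poly_time :: "(nat \<times> val \<times> val set) set \<Rightarrow> bool" where
  "solvable_in_poly_time P \<longleftrightarrow>
     (\<exists>c. \<exists>p :: nat poly. oracle_free c \<and> (\<forall>(N, v, Out) \<in> P. \<forall>orc.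
        \<exists>w t. runs orc c v w t \<and> w \<in> Out \<and> t \<le> poly p N))"

section \<open>Encodings\<close>

primrec enc_list :: "('a \<Rightarrow> val) \<Rightarrow> 'a list \<Rightarrow> val" where
  "enc_list f [] = Atom 0"
| "enc_list f (x # xs) = Node (f x) (enc_list f xs)"

definition enc_rat :: "rat \<Rightarrow> val" where
  "enc_rat r = (case quotient_of r of (a, b) \<Rightarrow> Node (Atom a) (Atom b))"

definition rat_vec :: "real vec \<Rightarrow> bool" where
  "rat_vec v \<longleftrightarrow> (\<forall>i < dim_vec v. v $ i \<in> \<rat>)"

text \<open>Only meaningful for vectors with rational entries.\<close>

definition enc_vec :: "real vec \<Rightarrow> val" where
  "enc_vec v = enc_list (\<lambda>r. enc_rat (THE a. r = of_rat a)) (list_of_vec v)"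

section \<open>Min-max-min robust optimization\<close>

text \<open>
  \<open>desc\<close> is the description of the uncertainty set that algorithms receive as input; the
  feasible set is accessible through oracles only.
\<close>

datatype inst = Inst (inst_dim: nat) (feas: "real vec set") (unc: "real vec set") (desc: val)

definition scenario_value :: "real vec \<Rightarrow> real vec list \<Rightarrow> real" where
  "scenario_value c xs = Min ((\<lambda>x. c \<bullet> x) ` set xs)"

definition is_max_on :: "('a \<Rightarrow> real) \<Rightarrow> 'a set \<Rightarrow> 'a \<Rightarrow> bool" where
  "is_max_on f S a \<longleftrightarrow> a \<in> S \<and> (\<forall>b \<in> S. f b \<le> f a)"

definition valid_inst :: "inst \<Rightarrow> bool" where
  "valid_inst I \<longleftrightarrow>
     1 \<le> inst_dim I \<and>
     feas I \<noteq> {} \<and>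
     feas I \<subseteq> {x \<in> carrier_vec (inst_dim I). \<forall>i < inst_dim I. x $ i \<in> {0, 1}} \<and>
     unc I \<noteq> {} \<and>
     unc I \<subseteq> {c \<in> carrier_vec (inst_dim I). \<forall>i < inst_dim I. 0 \<le> c $ i} \<and>
     (\<forall>c \<in> unc I. \<forall>d \<in> unc I. \<forall>t \<in> {0..1}. (1 - t) \<cdot>\<^sub>v c + t \<cdot>\<^sub>v d \<in> unc I) \<and>
     (\<forall>w \<in> carrier_vec (inst_dim I). \<exists>c. is_max_on (\<lambda>c. c \<bullet> w) (unc I) c) \<and>
     (\<forall>xs. xs \<noteq> [] \<longrightarrow> set xs \<subseteq> feas I \<longrightarrow>
        (\<exists>c. is_max_on (\<lambda>c. scenario_value c xs) (unc I) c))"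

definition m3_feasible :: "inst \<Rightarrow> nat \<Rightarrow> real vec list set" where
  "m3_feasible I k = {xs. length xs = k \<and> set xs \<subseteq> feas I}"

text \<open>The supremum is a maximum for valid instances.\<close>

definition m3_value :: "inst \<Rightarrow> real vec list \<Rightarrow> real" where
  "m3_value I xs = (SUP c \<in> unc I. scenario_value c xs)"

definition m3_opt :: "inst \<Rightarrow> nat \<Rightarrow> real" where
  "m3_opt I k = Min (m3_value I ` m3_feasible I k)"

definition card_supp :: "real vec \<Rightarrow> nat" where
  "card_supp x = card {i. i < dim_vec x \<and> x $ i \<noteq> 0}"

definition cardinality_bounds :: "inst set \<Rightarrow> (nat \<Rightarrow> real) \<Rightarrow> (nat \<Rightarrow> real) \<Rightarrow> bool" where
  "cardinality_bounds \<C> pl pu \<longleftrightarrow>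
     (\<forall>I \<in> \<C>. \<forall>x \<in> feas I. pl (inst_dim I) \<le> real (card_supp x) \<and> real (card_supp x) \<le> pu (inst_dim I))"

definition cost_bounds :: "inst set \<Rightarrow> real \<Rightarrow> real \<Rightarrow> bool" where
  "cost_bounds \<C> m M \<longleftrightarrow>
     (\<forall>I \<in> \<C>. \<forall>c \<in> unc I. \<forall>j < inst_dim I. m \<le> c $ j \<and> c $ j \<le> M)"

text \<open>The answer to a query that does not encode an element of the uncertainty set is arbitrary.\<close>

definition opt_oracles :: "inst \<Rightarrow> oracle_fun set" where
  "opt_oracles I = {orc. \<forall>c \<in> unc I. rat_vec c \<longrightarrow>
     orc (enc_vec c) \<in> enc_vec ` {x \<in> feas I. \<forall>y \<in> feas I. c \<bullet> x \<le> c \<bullet> y}}"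

definition weight_simplex :: "nat \<Rightarrow> real vec set" where
  "weight_simplex n = {l \<in> carrier_vec n. (\<forall>i < n. 0 \<le> l $ i) \<and> (\<Sum>i < n. l $ i) = 1}"

definition combination :: "nat \<Rightarrow> real vec \<Rightarrow> real vec list \<Rightarrow> real vec" where
  "combination n l xs = vec n (\<lambda>j. \<Sum>i < length xs. l $ i * (xs ! i) $ j)"

definition weights_value :: "inst \<Rightarrow> real vec list \<Rightarrow> real vec \<Rightarrow> real" where
  "weights_value I xs l = (SUP c \<in> unc I. c \<bullet> combination (inst_dim I) l xs)"

definition optimal_weights :: "inst \<Rightarrow> real vec list \<Rightarrow> real vec set" where
  "optimal_weights I xs =
     {l \<in> weight_simplex (length xs). \<forall>l' \<in> weight_simplex (length xs). weights_value I xs l \<le> weights_value I xs l'}"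

section \<open>The computational problems\<close>

text \<open>
  The size parameter is the dimension, except that for linear maximization the encoding length
  of the objective, which is an arbitrary rational vector, is added.
\<close>

definition linear_max_problem :: "inst set \<Rightarrow> (nat \<times> val \<times> val set) set" where
  "linear_max_problem \<C> =
     {(inst_dim I + val_len (enc_vec w),
       Node (Atom (int (inst_dim I))) (Node (enc_vec w) (desc I)),
       enc_vec ` {c. is_max_on (\<lambda>c. c \<bullet> w) (unc I) c \<and> rat_vec c})
      | I w. I \<in> \<C> \<and> w \<in> carrier_vec (inst_dim I) \<and> rat_vec w}"

definition weights_problem :: "inst set \<Rightarrow> (nat \<times> val \<times> val set) set" where
  "weights_problem \<C> =
     {(inst_dim I,
       Node (Atom (int (inst_dim I))) (Node (enc_list enc_vec xs) (desc I)),
       enc_vec ` {l \<in> optimal_weights I xs. rat_vec l})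
      | I xs. I \<in> \<C> \<and> length xs = inst_dim I \<and> set xs \<subseteq> feas I}"

definition m3_dim_problem :: "inst set \<Rightarrow> (nat \<times> val \<times> oracle_fun set \<times> val set) set" where
  "m3_dim_problem \<C> =
     {(inst_dim I,
       Node (Atom (int (inst_dim I))) (desc I),
       opt_oracles I,
       enc_list enc_vec ` {xs \<in> m3_feasible I (inst_dim I). m3_value I xs = m3_opt I (inst_dim I)})
      | I. I \<in> \<C>}"

definition m3_approx_problem ::
    "real \<Rightarrow> (inst \<times> nat) set \<Rightarrow> (nat \<times> val \<times> oracle_fun set \<times> val set) set" where
  "m3_approx_problem \<alpha> \<P> =
     {(inst_dim I,
       Node (Atom (int (inst_dim I))) (Node (Atom (int k)) (desc I)),
       opt_oracles I,
       enc_list enc_vec ` {xs \<in> m3_feasible I k. m3_value I xs \<le> \<alpha> * m3_opt I k})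
      | I k. (I, k) \<in> \<P>}"

end

theory Submission
  imports Defs
begin

text \<open>
  Solve \<open>M\<^sup>3(n)\<close>, compute optimal weights \<open>\<lambda>\<close> for the \<open>n\<close> solutions found, and keep the \<open>k\<close>
  solutions of largest weight. Their total weight \<open>\<Lambda>\<close> is at least \<open>k / n = q\<close>. Costs are nonnegative,
  so in every scenario the minimum over the kept solutions is at most their weighted average, hence
  at most \<open>1 / \<Lambda>\<close> times the cost of the full convex combination. By minimax, the worst-case cost of
  that combination is \<open>opt(n) \<le> opt(k)\<close>, and \<open>1 / q \<le> 1 + \<epsilon> m / M \<le> 1 + \<epsilon>\<close>.
\<close>

section \<open>A minimax theorem for finitely many functions\<close>

text \<open>Convexity of the image of \<open>C\<close> under \<open>c \<mapsto> (f i c)\<close>,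
  \<open>i\<close> in \<open>J\<close>. No linear structure on \<open>C\<close> is involved, so the
  induction below can pass to a part of \<open>C\<close>.\<close>

definition convexlike :: "'i set \<Rightarrow> 'a set \<Rightarrow> ('i \<Rightarrow> 'a \<Rightarrow> real) \<Rightarrow> bool" where
  "convexlike J C f \<longleftrightarrow> (\<forall>c\<in>C. \<forall>d\<in>C. \<forall>t\<in>{0..1}. \<exists>e\<in>C. \<forall>i\<in>J. f i e = (1 - t) * f i c + t * f i d)"

text \<open>The points \<open>(f c, g c)\<close> form a convex planar set missing the open positive
  quadrant, so a line through the origin with nonnegative normal \<open>(1 - t, t)\<close> separates
  the two. Points with \<open>f c > 0\<close> force lower bounds on \<open>t\<close>, points with
  \<open>g c > 0\<close> upper bounds, and convexity makes these compatible.\<close>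

lemma two_function_alternative:
  fixes f g :: "'a \<Rightarrow> real"
  assumes conv: "\<And>c d t. c \<in> C \<Longrightarrow> d \<in> C \<Longrightarrow> 0 \<le> t \<Longrightarrow> t \<le> 1 \<Longrightarrow>
      \<exists>e\<in>C. f e = (1 - t) * f c + t * f d \<and> g e = (1 - t) * g c + t * g d"
    and nonpos: "\<And>c. c \<in> C \<Longrightarrow> f c \<le> 0 \<or> g c \<le> 0"
  shows "\<exists>t. 0 \<le> t \<and> t \<le> 1 \<and> (\<forall>c\<in>C. (1 - t) * f c + t * g c \<le> 0)"
proof -
  \<comment> \<open>Solving \<open>(1 - t) * f c + t * g c \<le> 0\<close> for \<open>t\<close> when
    \<open>f c > 0\<close> gives these lower bounds; \<open>0\<close> keeps the set nonempty and
    \<open>t\<close> nonnegative.\<close>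
  define T where "T = insert 0 ((\<lambda>c. f c / (f c - g c)) ` {c \<in> C. f c > 0})"
  have g_nonpos: "g c \<le> 0" if "c \<in> C" "f c > 0" for c
    using nonpos[OF that(1)] that(2) by simp
  have le1: "r \<le> 1" if "r \<in> T" for r
    using that g_nonpos unfolding T_def by (fastforce simp: divide_simps)
  have bdd: "bdd_above T"
    using le1 by (intro bdd_aboveI)
  define t where "t = Sup T"
  have "T \<noteq> {}" by (simp add: T_def)
  have t01: "0 \<le> t" "t \<le> 1"
    unfolding t_def using bdd le1 \<open>T \<noteq> {}\<close> by (auto intro: cSup_upper cSup_least simp: T_def)
  \<comment> \<open>This is "lower bound at most upper bound" with denominators cleared. Otherwise
    the segment between the two points would enter the positive quadrant.\<close>
  have cross: "f c * g d \<le> f d * g c" if c: "c \<in> C" "f c > 0" and d: "d \<in> C" "g d > 0" for c d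
  proof (rule ccontr)
    assume "\<not> ?thesis"
    then have less: "f d * g c < f c * g d" by simp
    have gc: "g c \<le> 0" and fd: "f d \<le> 0"
      using g_nonpos c nonpos[of d] d by auto
    define D where "D = (f c - f d) + (g d - g c)"
    have D: "D > 0" using c d gc fd by (simp add: D_def)
    \<comment> \<open>The segment meets the diagonal \<open>f = g\<close> at this parameter; both
      values there equal \<open>(f c * g d - f d * g c) / D\<close>.\<close>
    define s where "s = (f c - g c) / D"
    have s: "0 \<le> s" "s \<le> 1" "1 - s = (g d - f d) / D"
      using c d gc fd D by (auto simp: s_def D_def field_simps)
    obtain e where e: "e \<in> C" "f e = (1 - s) * f c + s * f d" "g e = (1 - s) * g c + s * g d"
      using conv[OF c(1) d(1) s(1,2)] by blast
    have "f e = (f c * g d - f d * g c) / D"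
      unfolding e s(3) unfolding s_def using D by (simp add: field_simps)
    moreover have "g e = (f c * g d - f d * g c) / D"
      unfolding e s(3) unfolding s_def using D by (simp add: field_simps)
    ultimately have "f e > 0" "g e > 0"
      using less D by auto
    then show False using nonpos[OF e(1)] by simp
  qed
  have "(1 - t) * f c + t * g c \<le> 0" if c: "c \<in> C" for c
  proof (cases "f c > 0")
    case True
    then have "f c / (f c - g c) \<le> t"
      unfolding t_def using bdd c by (intro cSup_upper) (auto simp: T_def)
    with True g_nonpos[OF c] show ?thesis by (simp add: field_simps)
  next
    case f: False
    show ?thesis
    proof (cases "g c > 0")
      case True
      \<comment> \<open>The upper bound forced by a point with \<open>g c > 0\<close>; the
        nontrivial elements of \<open>T\<close> respect it by \<open>cross\<close>.\<close>
      have "t \<le> - f c / (g c - f c)"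
        unfolding t_def
      proof (rule cSup_least[OF \<open>T \<noteq> {}\<close>])
        fix r assume "r \<in> T"
        then consider "r = 0" | d where "d \<in> C" "f d > 0" "r = f d / (f d - g d)"
          unfolding T_def by blast
        then show "r \<le> - f c / (g c - f c)"
        proof cases
          case 1
          with f True show ?thesis by (simp add: divide_simps)
        next
          case 2
          have frac_le: "x / a \<le> y / b" if "0 < a" "0 < b" "x * b \<le> y * a" for x y a b :: real
            using that by (simp add: pos_divide_le_eq pos_le_divide_eq)
          have "f d * (g c - f c) \<le> - f c * (f d - g d)"
            using cross[OF 2(1,2) c True] by (simp add: algebra_simps)
          then show ?thesis
            unfolding 2(3) using g_nonpos[OF 2(1,2)] 2(2) f True by (intro frac_le) auto
        qed
      qed
      with f True show ?thesis by (simp add: field_simps)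
    next
      case False
      with f t01 show ?thesis
        by (smt (verit) mult_nonneg_nonpos)
    qed
  qed
  with t01 show ?thesis by blast
qed

text \<open>
  Induction on the number of functions: combine all but the last one on the part of \<open>C\<close> where the
  last one is positive; the combination and the last function then form a pair as above.
\<close>

lemma convexlike_alternative:
  fixes f :: "nat \<Rightarrow> 'a \<Rightarrow> real"
  assumes "n \<ge> 1" "convexlike {..<n} C f" "\<And>c. c \<in> C \<Longrightarrow> \<exists>i<n. f i c \<le> 0"
  shows "\<exists>w. (\<forall>i<n. 0 \<le> w i) \<and> (\<Sum>i<n. w i) = 1 \<and> (\<forall>c\<in>C. (\<Sum>i<n. w i * f i c) \<le> 0)"
  using assms
proof (induction n arbitrary: C rule: nat_induct_at_least)
  case base
  then show ?case by (intro exI[of _ "\<lambda>_. 1"]) auto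
next
  case (Suc n)
  define C' where "C' = {c \<in> C. f n c > 0}"
  have "convexlike {..<n} C' f"
    unfolding convexlike_def
  proof (intro ballI)
    fix c d and t :: real assume cd: "c \<in> C'" "d \<in> C'" and t: "t \<in> {0..1}"
    then obtain e where e: "e \<in> C" "\<forall>i<Suc n. f i e = (1 - t) * f i c + t * f i d"
      using Suc.prems(1) unfolding convexlike_def C'_def by blast
    have "f n e > 0"
    proof (cases "t = 0")
      case False
      with cd t have "0 \<le> (1 - t) * f n c" "0 < t * f n d" by (auto simp: C'_def)
      with e show ?thesis by simp
    qed (use cd e in \<open>simp add: C'_def\<close>)
    with e show "\<exists>e\<in>C'. \<forall>i\<in>{..<n}. f i e = (1 - t) * f i c + t * f i d"
      by (intro bexI[of _ e]) (auto simp: C'_def)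
  qed
  moreover have "\<exists>i<n. f i c \<le> 0" if "c \<in> C'" for c
    using Suc.prems(2)[of c] that unfolding C'_def by (metis (mono_tags, lifting) less_antisym mem_Collect_eq not_le)
  ultimately obtain w where w: "\<forall>i<n. 0 \<le> w i" "(\<Sum>i<n. w i) = 1" "\<forall>c\<in>C'. (\<Sum>i<n. w i * f i c) \<le> 0"
    using Suc.IH[of C'] by blast
  define g where "g c = (\<Sum>i<n. w i * f i c)" for c
  have "\<exists>t. 0 \<le> t \<and> t \<le> 1 \<and> (\<forall>c\<in>C. (1 - t) * g c + t * f n c \<le> 0)"
  proof (rule two_function_alternative)
    fix c d and t :: real assume "c \<in> C" "d \<in> C" "0 \<le> t" "t \<le> 1"
    then obtain e where e: "e \<in> C" "\<forall>i\<in>{..<Suc n}. f i e = (1 - t) * f i c + t * f i d"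
      using Suc.prems(1) unfolding convexlike_def by (meson atLeastAtMost_iff)
    then have "g e = (\<Sum>i<n. w i * ((1 - t) * f i c + t * f i d))"
      unfolding g_def by (intro sum.cong) auto
    also have "\<dots> = (1 - t) * g c + t * g d"
      by (simp add: g_def sum_distrib_left sum.distrib distrib_left mult.left_commute)
    finally have "g e = (1 - t) * g c + t * g d" .
    with e show "\<exists>e\<in>C. g e = (1 - t) * g c + t * g d \<and> f n e = (1 - t) * f n c + t * f n d"
      by auto
  next
    fix c assume "c \<in> C"
    \<comment> \<open>On \<open>C'\<close> the induction hypothesis bounds \<open>g\<close>; off
      \<open>C'\<close> the last function is nonpositive.\<close>
    then show "g c \<le> 0 \<or> f n c \<le> 0"
      using w(3) unfolding g_def C'_def by fastforce
  qed
  then obtain t where t: "0 \<le> t" "t \<le> 1" "\<forall>c\<in>C. (1 - t) * g c + t * f n c \<le> 0"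
    by blast
  let ?w = "\<lambda>i. if i < n then (1 - t) * w i else t"
  have "(\<Sum>i<Suc n. ?w i) = 1"
    using w(2) by (simp add: sum_distrib_left[symmetric])
  moreover have "(\<Sum>i<Suc n. ?w i * f i c) = (1 - t) * g c + t * f n c" for c
    by (simp add: g_def sum_distrib_left mult.assoc)
  ultimately show ?case
    using w(1) t by (intro exI[of _ ?w]) auto
qed

section \<open>Selecting solutions of large weight\<close>

lemma scenario_value_le: "x \<in> set xs \<Longrightarrow> scenario_value c xs \<le> c \<bullet> x"
  unfolding scenario_value_def by simp

lemma scenario_value_attained:
  assumes "xs \<noteq> []"
  obtains x where "x \<in> set xs" "scenario_value c xs = c \<bullet> x"
proof -
  have "scenario_value c xs \<in> (\<lambda>x. c \<bullet> x) ` set xs"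
    unfolding scenario_value_def using assms by (intro Min_in) auto
  then show ?thesis using that by blast
qed

lemma scalar_prod_combination:
  assumes "c \<in> carrier_vec n" "set xs \<subseteq> carrier_vec n"
  shows "c \<bullet> combination n l xs = (\<Sum>i<length xs. l $ i * (c \<bullet> xs ! i))"
proof -
  have dim: "dim_vec (xs ! i) = n" if "i < length xs" for i
    using assms(2) that by (auto simp: subset_code(1))
  have "c \<bullet> combination n l xs = (\<Sum>j<n. \<Sum>i<length xs. l $ i * (c $ j * (xs ! i) $ j))"
    by (simp add: scalar_prod_def combination_def sum_distrib_left atLeast0LessThan mult.left_commute)
  also have "\<dots> = (\<Sum>i<length xs. l $ i * (c \<bullet> xs ! i))"
    using dim by (subst sum.swap) (simp add: scalar_prod_def sum_distrib_left atLeast0LessThan)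
  finally show ?thesis .
qed

section \<open>Finiteness, attainment and monotonicity of min-max-min values\<close>

lemma finite_feas:
  assumes "valid_inst I"
  shows "finite (feas I)"
proof -
  have "feas I \<subseteq> vec_of_list ` {xs. set xs \<subseteq> {0, 1} \<and> length xs = inst_dim I}"
  proof
    fix x assume "x \<in> feas I"
    with assms have x: "dim_vec x = inst_dim I" "\<forall>i<inst_dim I. x $ i \<in> {0, 1}"
      unfolding valid_inst_def by auto
    then have "set (list_of_vec x) \<subseteq> {0, 1}"
      by (auto simp: set_conv_nth list_of_vec_index)
    with x show "x \<in> vec_of_list ` {xs. set xs \<subseteq> {0, 1} \<and> length xs = inst_dim I}"
      by (intro image_eqI[of _ _ "list_of_vec x"]) (auto simp: vec_list)
  qed
  then show ?thesis
    by (rule finite_subset) (intro finite_imageI finite_lists_length_eq, simp)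
qed

text \<open>\<open>m3_opt\<close> is a \<open>Min\<close>, which is informative only over a finite
  nonempty set.\<close>

lemma m3_feasible_finite_nonempty:
  assumes "valid_inst I"
  shows "finite (m3_feasible I k)" "m3_feasible I k \<noteq> {}"
proof -
  show "finite (m3_feasible I k)"
    using finite_lists_length_eq[OF finite_feas[OF assms], of k]
    by (simp add: m3_feasible_def conj_commute)
  obtain x where "x \<in> feas I" using assms unfolding valid_inst_def by auto
  then have "replicate k x \<in> m3_feasible I k"
    by (auto simp: m3_feasible_def set_replicate_conv_if)
  then show "m3_feasible I k \<noteq> {}" by blast
qed

text \<open>A real \<open>SUP\<close> is known to dominate its members only under boundedness; the
  attained maximum granted by \<open>valid_inst\<close> supplies the bound.\<close>

lemma scenario_value_le_m3_value:
  assumes "valid_inst I" "xs \<noteq> []" "set xs \<subseteq> feas I" "c \<in> unc I"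
  shows "scenario_value c xs \<le> m3_value I xs"
proof -
  obtain d where "is_max_on (\<lambda>c. scenario_value c xs) (unc I) d"
    using assms unfolding valid_inst_def by blast
  then have "bdd_above ((\<lambda>c. scenario_value c xs) ` unc I)"
    unfolding is_max_on_def by (auto intro!: bdd_aboveI)
  then show ?thesis
    unfolding m3_value_def using assms(4) by (intro cSUP_upper)
qed

lemma scalar_prod_nonneg:
  assumes "valid_inst I" "c \<in> unc I" "x \<in> feas I"
  shows "0 \<le> c \<bullet> x"
proof -
  have "c \<in> carrier_vec (inst_dim I)" "\<forall>i<inst_dim I. 0 \<le> c $ i"
    using assms(1,2) unfolding valid_inst_def by blast+
  moreover have "x \<in> carrier_vec (inst_dim I)" "\<forall>i<inst_dim I. x $ i \<in> {0, 1}"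
    using assms(1,3) unfolding valid_inst_def by blast+
  ultimately show ?thesis
    unfolding scalar_prod_def by (intro sum_nonneg mult_nonneg_nonneg) force+
qed

lemma m3_value_nonneg:
  assumes "valid_inst I" "xs \<noteq> []" "set xs \<subseteq> feas I"
  shows "0 \<le> m3_value I xs"
proof -
  obtain c where c: "c \<in> unc I" using assms(1) unfolding valid_inst_def by auto
  obtain x where "x \<in> set xs" "scenario_value c xs = c \<bullet> x"
    using scenario_value_attained[OF assms(2)] .
  with scalar_prod_nonneg[OF assms(1) c] assms(3) have "0 \<le> scenario_value c xs" by auto
  with scenario_value_le_m3_value[OF assms c] show ?thesis by simp
qed

lemma m3_opt_attained:
  assumes "valid_inst I"
  obtains xs where "xs \<in> m3_feasible I k" "m3_value I xs = m3_opt I k"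
proof -
  have "m3_opt I k \<in> m3_value I ` m3_feasible I k"
    unfolding m3_opt_def using m3_feasible_finite_nonempty[OF assms] by (intro Min_in) auto
  then show ?thesis using that by auto
qed

text \<open>Padding an optimal list with copies of its head leaves the set of entries, hence every
  scenario value, unchanged.\<close>

lemma m3_opt_antimono:
  assumes "valid_inst I" "0 < k" "k \<le> n"
  shows "m3_opt I n \<le> m3_opt I k"
proof -
  obtain ys where ys: "ys \<in> m3_feasible I k" "m3_value I ys = m3_opt I k"
    using m3_opt_attained[OF assms(1)] .
  let ?zs = "ys @ replicate (n - k) (hd ys)"
  have "ys \<noteq> []" using ys(1) assms(2) by (auto simp: m3_feasible_def)
  then have "set ?zs = set ys" by (auto simp: set_replicate_conv_if)
  then have "?zs \<in> m3_feasible I n" "m3_value I ?zs = m3_value I ys"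
    using ys(1) assms(3) unfolding m3_feasible_def m3_value_def scenario_value_def by auto
  then have "m3_opt I n \<le> m3_value I ys"
    unfolding m3_opt_def using m3_feasible_finite_nonempty[OF assms(1)]
    by (metis Min_le finite_imageI image_eqI)
  with ys(2) show ?thesis by simp
qed

text \<open>The nontrivial half of minimax duality. The alternative above, applied to the costs of
  the \<open>xs ! i\<close> reduced by \<open>m3_value I xs\<close>, yields weights whose
  combination costs at most that value in every scenario; optimal weights do no worse.\<close>

lemma weights_value_optimal_le:
  assumes I: "valid_inst I" and xs: "xs \<noteq> []" "set xs \<subseteq> feas I" and l: "l \<in> optimal_weights I xs"
  shows "weights_value I xs l \<le> m3_value I xs"
proof -
  let ?n = "inst_dim I" and ?v = "m3_value I xs"
  let ?f = "\<lambda>i c. c \<bullet> xs ! i - ?v"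
  have U: "unc I \<subseteq> carrier_vec ?n" and X: "set xs \<subseteq> carrier_vec ?n"
    using I xs(2) unfolding valid_inst_def by auto
  have "convexlike {..<length xs} (unc I) ?f"
    unfolding convexlike_def
  proof (intro ballI)
    fix c d and t :: real assume cdt: "c \<in> unc I" "d \<in> unc I" "t \<in> {0..1}"
    then have "(1 - t) \<cdot>\<^sub>v c + t \<cdot>\<^sub>v d \<in> unc I"
      using I unfolding valid_inst_def by blast
    moreover have "((1 - t) \<cdot>\<^sub>v c + t \<cdot>\<^sub>v d) \<bullet> x = (1 - t) * (c \<bullet> x) + t * (d \<bullet> x)"
      if "x \<in> carrier_vec ?n" for x
    proof -
      have "c \<in> carrier_vec ?n" "d \<in> carrier_vec ?n" using cdt U by auto
      then show ?thesis using that by (subst add_scalar_prod_distrib[of _ ?n]) auto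
    qed
    ultimately show "\<exists>e\<in>unc I. \<forall>i\<in>{..<length xs}. ?f i e = (1 - t) * ?f i c + t * ?f i d"
      using X by (intro bexI[of _ "(1 - t) \<cdot>\<^sub>v c + t \<cdot>\<^sub>v d"]) (auto simp: algebra_simps subset_code(1))
  qed
  \<comment> \<open>The solution attaining the minimum in scenario \<open>c\<close> serves as
    witness.\<close>
  moreover have "\<exists>i<length xs. ?f i c \<le> 0" if "c \<in> unc I" for c
    using scenario_value_attained[OF xs(1), of c] scenario_value_le_m3_value[OF I xs that]
    by (metis diff_le_0_iff_le in_set_conv_nth)
  moreover have "length xs \<ge> 1" using xs(1) by (cases xs) auto
  ultimately obtain w where w: "\<forall>i<length xs. 0 \<le> w i" "(\<Sum>i<length xs. w i) = 1"
      "\<forall>c\<in>unc I. (\<Sum>i<length xs. w i * ?f i c) \<le> 0"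
    using convexlike_alternative[of "length xs" "unc I" ?f] by blast
  let ?w = "vec (length xs) w"
  have "?w \<in> weight_simplex (length xs)"
    using w by (simp add: weight_simplex_def)
  then have "weights_value I xs l \<le> weights_value I xs ?w"
    using l unfolding optimal_weights_def by blast
  also have "\<dots> \<le> ?v"
    unfolding weights_value_def
  proof (rule cSUP_least)
    show "unc I \<noteq> {}" using I unfolding valid_inst_def by blast
    fix c assume c: "c \<in> unc I"
    then have "c \<bullet> combination ?n ?w xs = (\<Sum>i<length xs. w i * (c \<bullet> xs ! i))"
      using scalar_prod_combination[of c ?n xs ?w] U X by auto
    also have "\<dots> = (\<Sum>i<length xs. w i * ?f i c) + ?v"
      using w(2) by (simp add: right_diff_distrib sum_subtractf sum_distrib_right[symmetric])
    also have "\<dots> \<le> ?v" using w(3) c by simp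
    finally show "c \<bullet> combination ?n ?w xs \<le> ?v" .
  qed
  finally show ?thesis .
qed

text \<open>Both averages are separated by the least selected value.\<close>

lemma sum_list_selection:
  fixes as bs :: "real list"
  assumes "as \<noteq> []" "\<forall>a\<in>set as. \<forall>b\<in>set bs. b \<le> a"
  shows "real (length as) * (sum_list as + sum_list bs) \<le> real (length as + length bs) * sum_list as"
proof -
  define \<mu> where "\<mu> = Min (set as)"
  have "\<mu> \<in> set as" "\<And>a. a \<in> set as \<Longrightarrow> \<mu> \<le> a"
    using assms(1) by (auto simp: \<mu>_def)
  have lower: "real (length as) * \<mu> \<le> sum_list as"
    using sum_list_mono[of as "\<lambda>_. \<mu>" "\<lambda>a. a"] \<open>\<And>a. a \<in> set as \<Longrightarrow> \<mu> \<le> a\<close>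
    by (simp add: sum_list_triv)
  have upper: "sum_list bs \<le> real (length bs) * \<mu>"
    using sum_list_mono[of bs "\<lambda>a. a" "\<lambda>_. \<mu>"] assms(2) \<open>\<mu> \<in> set as\<close>
    by (simp add: sum_list_triv)
  have "real (length as) * sum_list bs \<le> real (length as) * (real (length bs) * \<mu>)"
    using upper by (rule mult_left_mono) simp
  also have "\<dots> = real (length bs) * (real (length as) * \<mu>)" by simp
  also have "\<dots> \<le> real (length bs) * sum_list as"
    using lower by (rule mult_left_mono) simp
  finally show ?thesis by (simp add: algebra_simps)
qed

text \<open>The approximation ratio \<open>n / k\<close> with denominators cleared. Pairs of
  solution and weight are partitioned as multisets because solutions may repeat and weights may
  tie.\<close>

lemma m3_value_selection:
  fixes sel rem :: "(real vec \<times> rat) list"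
  assumes I: "valid_inst I" and n: "n = inst_dim I"
    and xs: "xs \<in> m3_feasible I n" "m3_value I xs = m3_opt I n"
    and l: "l \<in> optimal_weights I xs" and rs: "length rs = n" "\<forall>i<n. l $ i = of_rat (rs ! i)"
    and sel: "mset sel + mset rem = mset (zip xs rs)" "\<forall>a\<in>set sel. \<forall>b\<in>set rem. snd b \<le> snd a"
    and k: "length sel = k" "0 < k"
  shows "real k * m3_value I (map fst sel) \<le> real n * m3_opt I k"
proof -
  let ?r = "\<lambda>p :: real vec \<times> rat. real_of_rat (snd p)"
  let ?\<Lambda> = "\<Sum>p\<leftarrow>sel. ?r p"
  have len: "length xs = n" "set xs \<subseteq> feas I"
    using xs(1) by (auto simp: m3_feasible_def)
  have lens: "length sel + length rem = n"
    using arg_cong[OF sel(1), of size] len rs(1) by simp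
  have "xs \<noteq> []" using len lens k by auto
  \<comment> \<open>The multiset equation splits every sum over the pairs into a selected and a
    discarded part.\<close>
  have split: "(\<Sum>p\<leftarrow>sel. h p) + (\<Sum>p\<leftarrow>rem. h p) = (\<Sum>p\<leftarrow>zip xs rs. h p)" for h :: "_ \<Rightarrow> real"
    using arg_cong[OF sel(1), of "\<lambda>M. sum_mset (image_mset h M)"]
    by (simp add: sum_mset_sum_list flip: mset_map)
  have zip_sum: "(\<Sum>p\<leftarrow>zip xs rs. ?r p * h (fst p)) = (\<Sum>i<n. l $ i * h (xs ! i))" for h
    using len rs by (simp add: sum_list_sum_nth atLeast0LessThan)
  have l_simplex: "(\<Sum>i<n. l $ i) = 1" "\<forall>i<n. 0 \<le> l $ i"
    using l len by (auto simp: optimal_weights_def weight_simplex_def)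
  have mem: "p \<in> set sel \<union> set rem \<longleftrightarrow> p \<in> set (zip xs rs)" for p
    using arg_cong[OF sel(1), of set_mset] by auto
  have r_nonneg: "0 \<le> ?r p" and fst_feas: "fst p \<in> feas I" if "p \<in> set sel \<union> set rem" for p
    using that l_simplex(2) len rs unfolding mem by (auto simp: set_zip)
  have "real (length sel) * ((\<Sum>p\<leftarrow>sel. ?r p) + (\<Sum>p\<leftarrow>rem. ?r p)) \<le> real n * ?\<Lambda>"
    using sum_list_selection[of "map ?r sel" "map ?r rem"] sel(2) k lens by (auto simp: of_rat_less_eq)
  \<comment> \<open>All weights sum to \<open>1\<close>, so the averaging bound says that the
    selected weight is at least \<open>k / n\<close>.\<close>
  then have \<Lambda>: "real k \<le> real n * ?\<Lambda>"
    using split[of ?r] zip_sum[of "\<lambda>_. 1"] l_simplex(1) k by simp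
  have sel_feas: "map fst sel \<noteq> []" "set (map fst sel) \<subseteq> feas I"
    using k fst_feas by auto
  \<comment> \<open>With a worst scenario for the selection fixed, the chain of cost estimates runs
    at a single \<open>c\<close>.\<close>
  have "\<exists>c\<in>unc I. m3_value I (map fst sel) = scenario_value c (map fst sel)"
  proof -
    obtain c where "is_max_on (\<lambda>c. scenario_value c (map fst sel)) (unc I) c"
      using I sel_feas unfolding valid_inst_def by blast
    then show ?thesis
      unfolding m3_value_def is_max_on_def by (intro bexI[of _ c] cSup_eq_maximum) auto
  qed
  then obtain c where c: "c \<in> unc I" and val: "m3_value I (map fst sel) = scenario_value c (map fst sel)"
    by blast
  let ?v = "scenario_value c (map fst sel)"
  have v0: "0 \<le> ?v"
    using m3_value_nonneg[OF I sel_feas] val by simp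
  have "?\<Lambda> * ?v = (\<Sum>p\<leftarrow>sel. ?r p * ?v)"
    by (simp add: sum_list_mult_const)
  also have "\<dots> \<le> (\<Sum>p\<leftarrow>sel. ?r p * (c \<bullet> fst p))"
    using r_nonneg by (intro sum_list_mono mult_left_mono scenario_value_le) auto
  \<comment> \<open>Discarded solutions have nonnegative weight and nonnegative cost.\<close>
  also have "\<dots> \<le> (\<Sum>p\<leftarrow>sel. ?r p * (c \<bullet> fst p)) + (\<Sum>p\<leftarrow>rem. ?r p * (c \<bullet> fst p))"
  proof -
    have "0 \<le> ?r p * (c \<bullet> fst p)" if "p \<in> set rem" for p
      using that by (intro mult_nonneg_nonneg r_nonneg scalar_prod_nonneg[OF I c] fst_feas) auto
    then have "0 \<le> (\<Sum>p\<leftarrow>rem. ?r p * (c \<bullet> fst p))"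
      by (intro sum_list_nonneg) (metis (no_types, lifting) imageE set_map)
    then show ?thesis by simp
  qed
  also have "\<dots> = (\<Sum>i<n. l $ i * (c \<bullet> xs ! i))"
    using split[of "\<lambda>p. ?r p * (c \<bullet> fst p)"] zip_sum[of "\<lambda>x. c \<bullet> x"] by simp
  also have "\<dots> = c \<bullet> combination n l xs"
  proof -
    have "c \<in> carrier_vec n" "set xs \<subseteq> carrier_vec n"
      using I c len unfolding valid_inst_def n by auto
    then show ?thesis using scalar_prod_combination len by simp
  qed
  also have "\<dots> \<le> weights_value I xs l"
  proof -
    have "combination n l xs \<in> carrier_vec n" by (simp add: combination_def)
    then obtain d where "is_max_on (\<lambda>c. c \<bullet> combination n l xs) (unc I) d"
      using I unfolding valid_inst_def n by blast
    then have "bdd_above ((\<lambda>c. c \<bullet> combination n l xs) ` unc I)"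
      unfolding is_max_on_def by (auto intro!: bdd_aboveI)
    then show ?thesis
      unfolding weights_value_def n using c by (intro cSUP_upper) auto
  qed
  also have "\<dots> \<le> m3_opt I n"
    using weights_value_optimal_le[OF I \<open>xs \<noteq> []\<close> len(2) l] xs(2) by simp
  also have "\<dots> \<le> m3_opt I k"
    using m3_opt_antimono[OF I k(2)] lens k by simp
  finally have "?\<Lambda> * ?v \<le> m3_opt I k" .
  have "real k * ?v \<le> real n * ?\<Lambda> * ?v"
    using \<Lambda> v0 by (rule mult_right_mono)
  also have "\<dots> \<le> real n * m3_opt I k"
    using \<open>?\<Lambda> * ?v \<le> m3_opt I k\<close> by (simp add: mult.assoc mult_left_mono)
  finally show ?thesis by (simp add: val)
qed

section \<open>Running times of programs\<close>

text \<open>A weakest precondition for total correctness whose postcondition also sees the running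
  time. Execution is deterministic, so the existential describes the only outcome.\<close>

definition ensures :: "oracle_fun \<Rightarrow> com \<Rightarrow> store \<Rightarrow> (nat \<Rightarrow> store \<Rightarrow> bool) \<Rightarrow> bool" where
  "ensures orc c s Q \<longleftrightarrow> (\<exists>t s'. exec orc c s t s' \<and> Q t s')"

lemma ensures_mono:
  "ensures orc c s Q \<Longrightarrow> (\<And>t s'. Q t s' \<Longrightarrow> R t s') \<Longrightarrow> ensures orc c s R"
  unfolding ensures_def by blast

lemma ensures_Assign: "ensures orc (Assign x e) s Q \<longleftrightarrow> Q (1 + cost_exp e s) (s(x := eval_exp e s))"
  unfolding ensures_def by (metis exec.Assign exec_AssignE)

lemma ensures_Seq:
  "ensures orc (Seq c d) s Q \<longleftrightarrow> ensures orc c s (\<lambda>t s'. ensures orc d s' (\<lambda>t' s''. Q (t + t') s''))"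
  unfolding ensures_def by (metis exec.Seq exec_SeqE)

lemma ensures_Cond:
  "ensures orc (Cond e c d) s Q \<longleftrightarrow>
     ensures orc (if eval_exp e s \<noteq> Atom 0 then c else d) s (\<lambda>t s'. Q (1 + cost_exp e s + t) s')"
proof -
  have "exec orc (Cond e c d) s t s' \<longleftrightarrow>
      (\<exists>u. t = 1 + cost_exp e s + u \<and> exec orc (if eval_exp e s \<noteq> Atom 0 then c else d) s u s')" for t s'
    by (auto elim!: exec_CondE intro: exec.CondTrue[simplified] exec.CondFalse[simplified])
  note exec_Cond = this
  show ?thesis unfolding ensures_def exec_Cond by blast
qed

lemma ensures_While_True:
  assumes "eval_exp e s \<noteq> Atom 0"
    and "ensures orc (Seq c (While e c)) s (\<lambda>t s'. Q (1 + cost_exp e s + t) s')"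
  shows "ensures orc (While e c) s Q"
  using assms unfolding ensures_def
  by (metis (no_types, lifting) ab_semigroup_add_class.add_ac(1) exec.WhileTrue exec_SeqE)

lemma ensures_While_False:
  "eval_exp e s = Atom 0 \<Longrightarrow> Q (1 + cost_exp e s) s \<Longrightarrow> ensures orc (While e c) s Q"
  unfolding ensures_def using exec.WhileFalse by blast

text \<open>The time in \<open>runs\<close> includes the output length, which the call does not pay;
  hence the postcondition must cover every \<open>t' \<le> t\<close>.\<close>

lemma ensures_Call:
  assumes "runs orc c (eval_exp e s) w t" "\<And>t'. t' \<le> t \<Longrightarrow> Q (1 + cost_exp e s + t') (s(x := w))"
  shows "ensures orc (Call x c e) s Q"
  using assms unfolding ensures_def runs_def by (blast intro: exec.Call le_add1)

lemmas ensures_straight = ensures_Assign ensures_Seq ensures_Cond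

section \<open>Encoding lengths and comparison of rationals\<close>

lemma int_len_mult: "int_len (a * b) \<le> int_len a + int_len b"
proof -
  have less: "\<bar>x\<bar> < 2 ^ nat (bitlen \<bar>x\<bar>)" for x
    using bitlen_le_iff_power[of "\<bar>x\<bar>" "bitlen \<bar>x\<bar>"] by simp
  have "\<bar>a * b\<bar> < 2 ^ nat (bitlen \<bar>a\<bar>) * 2 ^ nat (bitlen \<bar>b\<bar>)"
    unfolding abs_mult using less by (intro mult_strict_mono') auto
  also have "\<dots> = 2 ^ nat (bitlen \<bar>a\<bar> + bitlen \<bar>b\<bar>)"
    by (simp add: power_add nat_add_distrib bitlen_nonneg)
  finally have "bitlen \<bar>a * b\<bar> \<le> bitlen \<bar>a\<bar> + bitlen \<bar>b\<bar>"
    by (simp add: bitlen_le_iff_power bitlen_nonneg)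
  then show ?thesis
    by (simp add: int_len_def nat_le_eq_zle bitlen_nonneg flip: nat_add_distrib)
qed

lemma int_len_of_nat: "int_len (int k) \<le> k + 1"
proof -
  have "int k < 2 ^ k" by (metis of_nat_less_numeral_power_cancel_iff less_exp)
  then have "bitlen (int k) \<le> int k" by (simp add: bitlen_le_iff_power)
  then show ?thesis by (simp add: int_len_def)
qed

lemma int_len_0 [simp]: "int_len 0 = 1" and int_len_1 [simp]: "int_len 1 = 2"
  by (simp_all add: int_len_def bitlen_alt_def)

lemma val_len_enc_list:
  "val_len (enc_list f xs) = 1 + (\<Sum>x\<leftarrow>xs. 1 + val_len (f x))"
  by (induction xs) auto

lemma val_len_le_enc_list: "x \<in> set xs \<Longrightarrow> val_len (f x) \<le> val_len (enc_list f xs)"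
  by (induction xs) auto

definition leq_rat_exp :: "exp \<Rightarrow> exp \<Rightarrow> exp" where
  "leq_rat_exp a b = Leq (Mul (Lft a) (Rgt b)) (Mul (Lft b) (Rgt a))"

text \<open>\<open>quotient_of\<close> returns positive denominators, so cross multiplication
  preserves the order.\<close>

lemma eval_leq_rat_exp:
  assumes "eval_exp a s = enc_rat p" "eval_exp b s = enc_rat q"
  shows "eval_exp (leq_rat_exp a b) s = truth (p \<le> q)"
  using assms
  by (simp add: leq_rat_exp_def enc_rat_def rat_less_eq_code mult.commute split: prod.split)

text \<open>Each argument is evaluated twice. Component lengths are paid once for the products and,
  by \<open>int_len_mult\<close>, at most once more for comparing these.\<close>

lemma cost_leq_rat_exp:
  assumes "eval_exp a s = enc_rat p" "eval_exp b s = enc_rat q"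
  shows "cost_exp (leq_rat_exp a b) s \<le>
    4 + 2 * (cost_exp a s + cost_exp b s) + 2 * (val_len (enc_rat p) + val_len (enc_rat q))"
proof -
  obtain a1 a2 b1 b2 where "quotient_of p = (a1, a2)" "quotient_of q = (b1, b2)"
    by (metis surj_pair)
  with assms int_len_mult[of a1 b2] int_len_mult[of b1 a2] show ?thesis
    by (simp add: leq_rat_exp_def enc_rat_def arith_cost_def)
qed

section \<open>The selection program\<close>

text \<open>
  The candidates are kept as two parallel lists, the solutions in variable 1 and their weights in
  variable 2. A pass over these lists leaves the heaviest candidate in variables 4 and 5 and moves
  the others to the lists in variables 6 and 7.
\<close>

definition scan_step :: com where
  "scan_step =
     Seq (Cond (leq_rat_exp (Lft (Var 2)) (Var 5))
       (Seq (Assign 6 (Mk (Lft (Var 1)) (Var 6))) (Assign 7 (Mk (Lft (Var 2)) (Var 7))))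
       (Seq (Assign 6 (Mk (Var 4) (Var 6))) (Seq (Assign 7 (Mk (Var 5) (Var 7)))
         (Seq (Assign 4 (Lft (Var 1))) (Assign 5 (Lft (Var 2)))))))
     (Seq (Assign 1 (Rgt (Var 1))) (Assign 2 (Rgt (Var 2))))"

text \<open>One round of selection by maximum extraction. The first candidate is the provisional
  maximum. Variable 3 counts the extractions left and variable 0 collects the extracted
  solutions.\<close>

definition extract_step :: com where
  "extract_step =
     Seq (Assign 4 (Lft (Var 1))) (Seq (Assign 5 (Lft (Var 2)))
     (Seq (Assign 1 (Rgt (Var 1))) (Seq (Assign 2 (Rgt (Var 2)))
     (Seq (Assign 6 (Const 0)) (Seq (Assign 7 (Const 0))
     (Seq (While (Var 1) scan_step)
     (Seq (Assign 0 (Mk (Var 4) (Var 0)))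
     (Seq (Assign 1 (Var 6)) (Seq (Assign 2 (Var 7))
     (Assign 3 (Sub (Var 3) (Const 1))))))))))))"

text \<open>The input holds \<open>n\<close>, \<open>k\<close> and the description; the subprograms
  are not given \<open>k\<close>. Variable 0 is then reset to \<open>Atom 0\<close>, the encoding of
  the empty list, and becomes the output.\<close>

definition approx_prog :: "com \<Rightarrow> com \<Rightarrow> com" where
  "approx_prog solve weigh =
     Seq (Call 1 solve (Mk (Lft (Var 0)) (Rgt (Rgt (Var 0)))))
     (Seq (Call 2 weigh (Mk (Lft (Var 0)) (Mk (Var 1) (Rgt (Rgt (Var 0))))))
     (Seq (Assign 3 (Lft (Rgt (Var 0))))
     (Seq (Assign 0 (Const 0))
     (While (Var 3) extract_step))))"

text \<open>One list of pairs stands for both parallel lists of the program, keeping each solution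
  tied to its weight.\<close>

abbreviation enc_fsts :: "('a \<Rightarrow> val) \<Rightarrow> ('a \<times> rat) list \<Rightarrow> val" where
  "enc_fsts f \<equiv> enc_list (\<lambda>p. f (fst p))"

abbreviation enc_snds :: "('a \<times> rat) list \<Rightarrow> val" where
  "enc_snds \<equiv> enc_list (\<lambda>p. enc_rat (snd p))"

text \<open>The invariant is that \<open>b\<close> is a heaviest pair scanned so far and
  \<open>acc\<close> holds the other scanned pairs. The result is fixed only up to order, since the
  scan rearranges the candidates.\<close>

lemma scan_loop:
  fixes ps acc :: "('a \<times> rat) list"
  assumes "s 1 = enc_fsts f ps" "s 2 = enc_snds ps" "s 4 = f (fst b)" "s 5 = enc_rat (snd b)"
    and "s 6 = enc_fsts f acc" "s 7 = enc_snds acc"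
    and "\<forall>p\<in>set (b # ps). val_len (enc_rat (snd p)) \<le> B"
    and "\<forall>p\<in>set acc. snd p \<le> snd b"
  shows "ensures orc (While (Var 1) scan_step) s (\<lambda>t s'. t \<le> 2 + length ps * (40 + 4 * B) \<and>
    (\<exists>b' acc'. s' 4 = f (fst b') \<and> s' 5 = enc_rat (snd b') \<and> s' 6 = enc_fsts f acc' \<and>
      s' 7 = enc_snds acc' \<and> mset (b' # acc') = mset (b # acc @ ps) \<and>
      (\<forall>p\<in>set acc'. snd p \<le> snd b') \<and> s' 0 = s 0 \<and> s' 3 = s 3))"
  using assms
proof (induction ps arbitrary: s b acc)
  case Nil
  then show ?case
    by (intro ensures_While_False conjI exI[of _ b] exI[of _ acc]) simp_all
next
  case (Cons p ps)
  let ?cmp = "leq_rat_exp (Lft (Var 2)) (Var 5)"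
  have ev: "eval_exp ?cmp s = truth (snd p \<le> snd b)"
    using Cons.prems by (intro eval_leq_rat_exp) auto
  have "cost_exp ?cmp s \<le> 4 + 2 * (cost_exp (Lft (Var 2)) s + cost_exp (Var 5) s)
      + 2 * (val_len (enc_rat (snd p)) + val_len (enc_rat (snd b)))"
    using Cons.prems by (intro cost_leq_rat_exp) auto
  also have "\<dots> \<le> 10 + 4 * B"
    using Cons.prems(7) by auto
  finally have cost: "cost_exp ?cmp s \<le> 10 + 4 * B" .
  define b1 where "b1 = (if snd p \<le> snd b then b else p)"
  define acc1 where "acc1 = (if snd p \<le> snd b then p else b) # acc"
  \<comment> \<open>Besides the comparison, the conditional costs 1, the longer branch 14 and the
    two final assignments 6; the bound leaves slack.\<close>
  have step: "ensures orc scan_step s (\<lambda>t s'. t \<le> 37 + 4 * B \<and>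
      s' 1 = enc_fsts f ps \<and> s' 2 = enc_snds ps \<and> s' 4 = f (fst b1) \<and> s' 5 = enc_rat (snd b1) \<and>
      s' 6 = enc_fsts f acc1 \<and> s' 7 = enc_snds acc1 \<and> s' 0 = s 0 \<and> s' 3 = s 3)"
    unfolding scan_step_def ensures_straight ev
    using cost Cons.prems(1-6) by (auto simp: ensures_straight truth_def b1_def acc1_def)
  show ?case
  proof (rule ensures_While_True)
    show "eval_exp (Var 1) s \<noteq> Atom 0" using Cons.prems(1) by simp
    show "ensures orc (Seq scan_step (While (Var 1) scan_step)) s (\<lambda>t s'.
      1 + cost_exp (Var 1) s + t \<le> 2 + length (p # ps) * (40 + 4 * B) \<and>
      (\<exists>b' acc'. s' 4 = f (fst b') \<and> s' 5 = enc_rat (snd b') \<and> s' 6 = enc_fsts f acc' \<and>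
        s' 7 = enc_snds acc' \<and> mset (b' # acc') = mset (b # acc @ p # ps) \<and>
        (\<forall>p\<in>set acc'. snd p \<le> snd b') \<and> s' 0 = s 0 \<and> s' 3 = s 3))"
      unfolding ensures_Seq
    proof (rule ensures_mono[OF step], elim conjE)
      fix t and s' :: store
      assume t: "t \<le> 37 + 4 * B"
        and s': "s' 1 = enc_fsts f ps" "s' 2 = enc_snds ps" "s' 4 = f (fst b1)" "s' 5 = enc_rat (snd b1)"
          "s' 6 = enc_fsts f acc1" "s' 7 = enc_snds acc1"
        and same: "s' 0 = s 0" "s' 3 = s 3"
      have invariant: "\<forall>q\<in>set (b1 # ps). val_len (enc_rat (snd q)) \<le> B" "\<forall>q\<in>set acc1. snd q \<le> snd b1"
        using Cons.prems(7,8) by (auto simp: b1_def acc1_def)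
      have mset_eq: "mset (b1 # acc1 @ ps) = mset (b # acc @ p # ps)"
        by (simp add: b1_def acc1_def)
      show "ensures orc (While (Var 1) scan_step) s' (\<lambda>t' s''.
        1 + cost_exp (Var 1) s + (t + t') \<le> 2 + length (p # ps) * (40 + 4 * B) \<and>
        (\<exists>b' acc'. s'' 4 = f (fst b') \<and> s'' 5 = enc_rat (snd b') \<and> s'' 6 = enc_fsts f acc' \<and>
          s'' 7 = enc_snds acc' \<and> mset (b' # acc') = mset (b # acc @ p # ps) \<and>
          (\<forall>p\<in>set acc'. snd p \<le> snd b') \<and> s'' 0 = s 0 \<and> s'' 3 = s 3))"
      proof (rule ensures_mono[OF Cons.IH[OF s' invariant]], goal_cases)
        case (1 t' s'')
        then obtain b' acc' where "t' \<le> 2 + length ps * (40 + 4 * B)"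
          and "s'' 4 = f (fst b')" "s'' 5 = enc_rat (snd b')" "s'' 6 = enc_fsts f acc'" "s'' 7 = enc_snds acc'"
            "mset (b' # acc') = mset (b1 # acc1 @ ps)" "\<forall>p\<in>set acc'. snd p \<le> snd b'"
            "s'' 0 = s' 0" "s'' 3 = s' 3"
          by blast
        with t same mset_eq show ?case
          by (intro conjI exI[of _ b'] exI[of _ acc']) simp_all
      qed
    qed
  qed
qed

lemma extract_step:
  fixes p :: "'a \<times> rat"
  assumes "s 1 = enc_fsts f (p # ps)" "s 2 = enc_snds (p # ps)"
    and "s 3 = Atom (int (Suc k))" "Suc k \<le> n" "length (p # ps) \<le> n"
    and "\<forall>q\<in>set (p # ps). val_len (enc_rat (snd q)) \<le> B"
  shows "ensures orc extract_step s (\<lambda>t s'. t \<le> 40 + n * (41 + 4 * B) \<and>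
    (\<exists>b qs. s' 0 = Node (f (fst b)) (s 0) \<and> s' 1 = enc_fsts f qs \<and> s' 2 = enc_snds qs \<and>
      s' 3 = Atom (int k) \<and> mset (b # qs) = mset (p # ps) \<and> (\<forall>q\<in>set qs. snd q \<le> snd b)))"
proof -
  have "length ps * (40 + 4 * B) \<le> n * (40 + 4 * B)"
    using assms(5) by (intro mult_right_mono) auto
  \<comment> \<open>The additional \<open>n\<close> pays for decrementing the counter, whose length
    is at most \<open>n + 1\<close>.\<close>
  then have bound: "length ps * (40 + 4 * B) + n \<le> n * (41 + 4 * B)"
    by (simp add: algebra_simps)
  have int_len_k: "int_len (1 + int k) \<le> n + 1"
    using int_len_of_nat[of "Suc k"] assms(4) by simp
  show ?thesis
    unfolding extract_step_def ensures_straight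
  proof (rule ensures_mono[OF scan_loop[where f = f and b = p and ps = ps and acc = "[]" and B = B]], goal_cases)
    \<comment> \<open>Goals 1 to 8 are the preconditions of the scan; the ninth starts from its
      postcondition.\<close>
    case (9 t s')
    then obtain b qs where t: "t \<le> 2 + length ps * (40 + 4 * B)"
      and s': "s' 4 = f (fst b)" "s' 6 = enc_fsts f qs" "s' 7 = enc_snds qs" "s' 0 = s 0" "s' 3 = s 3"
      and qs: "mset (b # qs) = mset (p # ps)" "\<forall>q\<in>set qs. snd q \<le> snd b"
      by auto
    show ?case
      using t bound int_len_k s' qs assms(3)
      by (intro conjI exI[of _ b] exI[of _ qs]) (simp_all add: arith_cost_def)
  qed (use assms in auto)
qed

text \<open>Each pair selected earlier dominates all remaining ones, and extracting a maximum of the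
  remainder preserves this. The loop test of cost 2 turns the \<open>40\<close> of a round into
  \<open>42\<close>.\<close>

lemma extract_loop:
  fixes ps sel :: "('a \<times> rat) list"
  assumes "s 0 = enc_fsts f sel" "s 1 = enc_fsts f ps" "s 2 = enc_snds ps" "s 3 = Atom (int k)"
    and "k \<le> length ps" "length ps \<le> n"
    and "\<forall>p\<in>set ps. val_len (enc_rat (snd p)) \<le> B"
    and "\<forall>a\<in>set sel. \<forall>p\<in>set ps. snd p \<le> snd a"
  shows "ensures orc (While (Var 3) extract_step) s (\<lambda>t s'. t \<le> 2 + k * (42 + n * (41 + 4 * B)) \<and>
    (\<exists>sel' rem. s' 0 = enc_fsts f sel' \<and> mset sel' + mset rem = mset sel + mset ps \<and>
      length sel' = length sel + k \<and> (\<forall>a\<in>set sel'. \<forall>p\<in>set rem. snd p \<le> snd a)))"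
  using assms
proof (induction k arbitrary: s sel ps)
  case 0
  then show ?case
    by (intro ensures_While_False conjI exI[of _ sel] exI[of _ ps]) simp_all
next
  case (Suc k)
  then obtain p ps' where ps: "ps = p # ps'" by (cases ps) auto
  show ?case
  proof (rule ensures_While_True)
    show "eval_exp (Var 3) s \<noteq> Atom 0" using Suc.prems(4) by simp
    show "ensures orc (Seq extract_step (While (Var 3) extract_step)) s (\<lambda>t s'.
      1 + cost_exp (Var 3) s + t \<le> 2 + Suc k * (42 + n * (41 + 4 * B)) \<and>
      (\<exists>sel' rem. s' 0 = enc_fsts f sel' \<and> mset sel' + mset rem = mset sel + mset ps \<and>
        length sel' = length sel + Suc k \<and> (\<forall>a\<in>set sel'. \<forall>p\<in>set rem. snd p \<le> snd a)))"
      unfolding ensures_Seq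
    proof (rule ensures_mono[OF extract_step[where f = f and p = p and ps = ps' and n = n and k = k and B = B]], goal_cases)
      case (7 t s')
      then obtain b qs where t: "t \<le> 40 + n * (41 + 4 * B)"
        and s': "s' 0 = enc_fsts f (b # sel)" "s' 1 = enc_fsts f qs" "s' 2 = enc_snds qs" "s' 3 = Atom (int k)"
        and qs: "mset (b # qs) = mset ps" "\<forall>q\<in>set qs. snd q \<le> snd b"
        using Suc.prems(1) by (auto simp: ps)
      \<comment> \<open>The rest \<open>qs\<close> lies inside \<open>ps\<close>, so the bound
        \<open>B\<close> and domination by earlier selections carry over; domination by
        \<open>b\<close> comes from the extraction.\<close>
      have set_ps: "set ps = insert b (set qs)" and len: "length ps = Suc (length qs)"
        using mset_eq_setD[OF qs(1)] mset_eq_length[OF qs(1)] by auto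
      have "ensures orc (While (Var 3) extract_step) s' (\<lambda>t s''. t \<le> 2 + k * (42 + n * (41 + 4 * B)) \<and>
        (\<exists>sel' rem. s'' 0 = enc_fsts f sel' \<and> mset sel' + mset rem = mset (b # sel) + mset qs \<and>
          length sel' = length (b # sel) + k \<and> (\<forall>a\<in>set sel'. \<forall>p\<in>set rem. snd p \<le> snd a)))"
        using Suc.prems(5-8) qs(2) set_ps len by (intro Suc.IH[OF s']) auto
      then show ?case
      proof (rule ensures_mono, goal_cases)
        case (1 t' s'')
        then obtain sel' rem where t': "t' \<le> 2 + k * (42 + n * (41 + 4 * B))"
          and sel': "s'' 0 = enc_fsts f sel'" "mset sel' + mset rem = mset (b # sel) + mset qs"
            "length sel' = length (b # sel) + k" "\<forall>a\<in>set sel'. \<forall>p\<in>set rem. snd p \<le> snd a"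
          by blast
        have "mset (b # sel) + mset qs = mset sel + mset ps"
          by (simp flip: qs(1))
        with t t' sel' show ?case
          by (intro conjI exI[of _ sel'] exI[of _ rem]) simp_all
      qed
    qed (use Suc.prems ps in auto)
  qed
qed

section \<open>Correctness and running time of the complete program\<close>

lemma enc_list_map: "enc_list f (map g xs) = enc_list (\<lambda>x. f (g x)) xs"
  by (induction xs) auto

lemma fst_selected:
  assumes "mset sel + mset rem = mset (zip xs rs)" "p \<in> set sel"
  shows "fst p \<in> set xs"
proof -
  have "p \<in># mset (zip xs rs)"
    unfolding assms(1)[symmetric] using assms(2) by simp
  then show ?thesis
    by (metis in_set_zipE prod.collapse set_mset_mset)
qed

text \<open>Writing the output is charged in \<open>runs\<close>, so \<open>t1\<close> bounds the
  length of every solution and \<open>t2\<close> that of every weight. This controls both the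
  comparisons and the length of the final output.\<close>

lemma approx_prog_runs:
  assumes solve: "runs orc solve (Node (Atom (int n)) u) (enc_list f xs) t1"
    and weigh: "runs orc weigh (Node (Atom (int n)) (Node (enc_list f xs) u)) (enc_list enc_rat rs) t2"
    and len: "length xs = n" "length rs = n" and "k \<le> n"
  obtains sel rem t where
    "runs orc (approx_prog solve weigh) (Node (Atom (int n)) (Node (Atom (int k)) u)) (enc_fsts f sel) t"
    "mset sel + mset rem = mset (zip xs rs)" "length sel = k"
    "\<forall>a\<in>set sel. \<forall>b\<in>set rem. snd b \<le> snd a"
    "t \<le> t1 + t2 + 40 + n * (50 + t1 + n * (41 + 4 * t2))"
proof -
  let ?ps = "zip xs rs"
  have enc: "enc_list f xs = enc_fsts f ?ps" "enc_list enc_rat rs = enc_snds ?ps"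
    using len enc_list_map[of f fst ?ps] enc_list_map[of enc_rat snd ?ps] by simp_all
  have short: "val_len (f x) \<le> t1" if "x \<in> set xs" for x
    using val_len_le_enc_list[OF that, of f] solve by (auto simp: runs_def)
  have "val_len (enc_rat r) \<le> t2" if "r \<in> set rs" for r
    using val_len_le_enc_list[OF that, of enc_rat] weigh by (auto simp: runs_def)
  then have B: "\<forall>p\<in>set ?ps. val_len (enc_rat (snd p)) \<le> t2"
    by (auto dest: set_zip_rightD)
  have "ensures orc (approx_prog solve weigh) (init_store (Node (Atom (int n)) (Node (Atom (int k)) u)))
    (\<lambda>t s'. t \<le> t1 + t2 + 30 + k * (42 + n * (41 + 4 * t2)) \<and>
      (\<exists>sel rem. s' 0 = enc_fsts f sel \<and> mset sel + mset rem = mset ?ps \<and> length sel = k \<and>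
        (\<forall>a\<in>set sel. \<forall>b\<in>set rem. snd b \<le> snd a)))"
    unfolding approx_prog_def ensures_Seq
  proof (rule ensures_Call[where w = "enc_list f xs" and t = t1], goal_cases)
    case 1
    show ?case using solve by (simp add: init_store_def)
  next
    case (2 t)
    show ?case
    proof (rule ensures_Call[where w = "enc_list enc_rat rs" and t = t2], goal_cases)
      case 1
      show ?case using weigh by (simp add: init_store_def)
    next
      case (2 t')
      show ?case
        unfolding ensures_Assign
      proof (rule ensures_mono[OF extract_loop[where f = f and ps = ?ps and sel = "[]" and k = k and n = n and B = t2]], goal_cases)
        case (9 t'' s')
        with \<open>t \<le> t1\<close> \<open>t' \<le> t2\<close> show ?case by auto
      next
        case 2
        show ?case by (simp add: init_store_def enc(1))
      next
        case 3
        show ?case by (simp add: init_store_def enc(2))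
      next
        case 5
        show ?case using len \<open>k \<le> n\<close> by simp
      next
        case 6
        show ?case using len by simp
      next
        case 7
        show ?case using B .
      qed (simp_all add: init_store_def)
    qed
  qed
  then obtain t s' sel rem where t: "t \<le> t1 + t2 + 30 + k * (42 + n * (41 + 4 * t2))"
    and exec: "exec orc (approx_prog solve weigh) (init_store (Node (Atom (int n)) (Node (Atom (int k)) u))) t s'"
      "s' 0 = enc_fsts f sel"
    and sel: "mset sel + mset rem = mset ?ps" "length sel = k" "\<forall>a\<in>set sel. \<forall>b\<in>set rem. snd b \<le> snd a"
    unfolding ensures_def by blast
  have run: "runs orc (approx_prog solve weigh) (Node (Atom (int n)) (Node (Atom (int k)) u)) (enc_fsts f sel)
      (t + val_len (enc_fsts f sel))"
    unfolding runs_def using exec by (intro exI[of _ t] exI[of _ s']) simp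
  have "fst p \<in> set xs" if "p \<in> set sel" for p
    using fst_selected[OF sel(1) that] .
  then have "(\<Sum>p\<leftarrow>sel. 1 + val_len (f (fst p))) \<le> (\<Sum>p\<leftarrow>sel. 1 + t1)"
    using short by (intro sum_list_mono) auto
  then have "val_len (enc_fsts f sel) \<le> 1 + k * (1 + t1)"
    using sel(2) by (simp add: val_len_enc_list sum_list_triv)
  with t have "t + val_len (enc_fsts f sel) \<le> t1 + t2 + 31 + k * (43 + t1 + n * (41 + 4 * t2))"
    by (simp add: algebra_simps)
  \<comment> \<open>Replacing \<open>k\<close> by \<open>n\<close> and rounding constants up gives a
    bound free of \<open>k\<close>.\<close>
  also have "\<dots> \<le> t1 + t2 + 40 + n * (50 + t1 + n * (41 + 4 * t2))"
    using \<open>k \<le> n\<close> by (intro add_mono mult_mono) auto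
  finally show ?thesis using that[OF run sel] by blast
qed

text \<open>Since \<open>of_rat\<close> is injective, the \<open>THE\<close> in
  \<open>enc_vec\<close> finds the intended rational at each entry.\<close>

lemma enc_vec_rat:
  assumes "rat_vec l"
  obtains rs where "enc_vec l = enc_list enc_rat rs" "length rs = dim_vec l"
    "\<forall>i<dim_vec l. l $ i = of_rat (rs ! i)"
proof
  let ?rs = "map (\<lambda>r. THE a. r = of_rat a) (list_of_vec l)"
  show "enc_vec l = enc_list enc_rat ?rs" by (simp add: enc_vec_def enc_list_map)
  show "length ?rs = dim_vec l" by simp
  show "\<forall>i<dim_vec l. l $ i = of_rat (?rs ! i)"
  proof (intro allI impI)
    fix i assume i: "i < dim_vec l"
    with assms have "l $ i \<in> \<rat>" by (simp add: rat_vec_def)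
    then obtain a where "l $ i = of_rat a" by (rule Rats_cases)
    with i show "l $ i = of_rat (?rs ! i)" by simp
  qed
qed

section \<open>Solvability predicates and the approximation theorem\<close>

lemma solvable_in_oracle_poly_timeE:
  assumes "solvable_in_oracle_poly_time P"
  obtains c p where "\<And>N v Orc Out orc. (N, v, Orc, Out) \<in> P \<Longrightarrow> orc \<in> Orc \<Longrightarrow>
    \<exists>w t. runs orc c v w t \<and> w \<in> Out \<and> t \<le> poly p N"
proof -
  from assms obtain c p where *: "\<forall>(N, v, Orc, Out) \<in> P. \<forall>orc \<in> Orc.
      \<exists>w t. runs orc c v w t \<and> w \<in> Out \<and> t \<le> poly p N"
    unfolding solvable_in_oracle_poly_time_def by (elim exE)
  show ?thesis
  proof (rule that)
    fix N v Orc Out orc assume "(N, v, Orc, Out) \<in> P" "orc \<in> Orc"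
    with bspec[OF *, of "(N, v, Orc, Out)"]
    show "\<exists>w t. runs orc c v w t \<and> w \<in> Out \<and> t \<le> poly p N" by simp
  qed
qed

text \<open>The program succeeds under every oracle, so it can be called from one that runs with an
  optimization oracle.\<close>

lemma solvable_in_poly_timeE:
  assumes "solvable_in_poly_time P"
  obtains c p where "\<And>N v Out orc. (N, v, Out) \<in> P \<Longrightarrow>
    \<exists>w t. runs orc c v w t \<and> w \<in> Out \<and> t \<le> poly p N"
proof -
  from assms obtain c p where *: "\<forall>(N, v, Out) \<in> P. \<forall>orc.
      \<exists>w t. runs orc c v w t \<and> w \<in> Out \<and> t \<le> poly p N"
    unfolding solvable_in_poly_time_def by (elim exE conjE)
  show ?thesis
  proof (rule that)
    fix N v Out orc assume "(N, v, Out) \<in> P"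
    with bspec[OF *, of "(N, v, Out)"]
    show "\<exists>w t. runs orc c v w t \<and> w \<in> Out \<and> t \<le> poly p N" by simp
  qed
qed

lemma solvable_in_oracle_poly_timeI:
  assumes "\<And>N v Orc Out orc. (N, v, Orc, Out) \<in> P \<Longrightarrow> orc \<in> Orc \<Longrightarrow>
    \<exists>w t. runs orc c v w t \<and> w \<in> Out \<and> t \<le> poly p N"
  shows "solvable_in_oracle_poly_time P"
  unfolding solvable_in_oracle_poly_time_def
proof (intro exI[of _ c] exI[of _ p] ballI)
  fix x assume "x \<in> P"
  then show "case x of (N, v, Orc, Out) \<Rightarrow> \<forall>orc\<in>Orc. \<exists>w t. runs orc c v w t \<and> w \<in> Out \<and> t \<le> poly p N"
    by (cases x) (simp add: assms)
qed

theorem theorem14: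
  fixes \<C> :: "inst set"
    and pl pu :: "nat \<Rightarrow> real"
    and m M \<epsilon> :: real
  assumes "\<forall>I \<in> \<C>. valid_inst I"
    and "cardinality_bounds \<C> pl pu"
    and "\<forall>n \<ge> 1. pl n = pu n \<and> pu n > 0"
    and "cost_bounds \<C> m M" and "0 < m" and "m \<le> M"
    and "\<epsilon> > 0"
    and "solvable_in_poly_time (linear_max_problem \<C>)"
    and "solvable_in_oracle_poly_time (m3_dim_problem \<C>)"
    and "solvable_in_poly_time (weights_problem \<C>)"
  shows "solvable_in_oracle_poly_time
    (m3_approx_problem (1 + \<epsilon>)
      {(I, k). I \<in> \<C> \<and>
        (\<exists>q :: real. real k = q * real (inst_dim I) \<and> q \<in> {(M / m) / (\<epsilon> + M / m)..1})})"
proof -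
  obtain solve p1 where solve: "\<And>I orc. I \<in> \<C> \<Longrightarrow> orc \<in> opt_oracles I \<Longrightarrow>
      \<exists>w t. runs orc solve (Node (Atom (int (inst_dim I))) (desc I)) w t \<and>
        w \<in> enc_list enc_vec ` {xs \<in> m3_feasible I (inst_dim I). m3_value I xs = m3_opt I (inst_dim I)} \<and>
        t \<le> poly p1 (inst_dim I)"
  proof (rule solvable_in_oracle_poly_timeE[OF assms(9)])
    fix c p
    assume *: "\<And>N v Orc Out orc. (N, v, Orc, Out) \<in> m3_dim_problem \<C> \<Longrightarrow> orc \<in> Orc \<Longrightarrow>
      \<exists>w t. runs orc c v w t \<and> w \<in> Out \<and> t \<le> poly p N"
    show thesis
      by (rule that, rule *) (auto simp: m3_dim_problem_def)
  qed
  obtain weigh p2 where weigh: "\<And>I xs orc. I \<in> \<C> \<Longrightarrow> length xs = inst_dim I \<Longrightarrow> set xs \<subseteq> feas I \<Longrightarrow>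
      \<exists>w t. runs orc weigh (Node (Atom (int (inst_dim I))) (Node (enc_list enc_vec xs) (desc I))) w t \<and>
        w \<in> enc_vec ` {l \<in> optimal_weights I xs. rat_vec l} \<and> t \<le> poly p2 (inst_dim I)"
  proof (rule solvable_in_poly_timeE[OF assms(10)])
    fix c p
    assume *: "\<And>N v Out orc. (N, v, Out) \<in> weights_problem \<C> \<Longrightarrow>
      \<exists>w t. runs orc c v w t \<and> w \<in> Out \<and> t \<le> poly p N"
    show thesis
      by (rule that, rule *) (auto simp: weights_problem_def)
  qed
  \<comment> \<open>The time bound of \<open>approx_prog_runs\<close> as a polynomial, with
    \<open>[:0, 1:]\<close> standing for the dimension.\<close>
  define p :: "nat poly" where
    "p = p1 + p2 + [:40:] + [:0, 1:] * ([:50:] + p1 + [:0, 1:] * ([:41:] + [:4:] * p2))"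
  have poly_p: "poly p n = poly p1 n + poly p2 n + 40 + n * (50 + poly p1 n + n * (41 + 4 * poly p2 n))" for n
    by (simp add: p_def)
  have approx: "\<exists>w t. runs orc (approx_prog solve weigh)
        (Node (Atom (int (inst_dim I))) (Node (Atom (int k)) (desc I))) w t \<and>
      w \<in> enc_list enc_vec ` {xs \<in> m3_feasible I k. m3_value I xs \<le> (1 + \<epsilon>) * m3_opt I k} \<and>
      t \<le> poly p (inst_dim I)"
    if I: "I \<in> \<C>" and orc: "orc \<in> opt_oracles I"
      and q: "real k = q * real (inst_dim I)" "q \<in> {(M / m) / (\<epsilon> + M / m)..1}" for I k q orc
  proof -
    let ?n = "inst_dim I"
    have valid: "valid_inst I" using assms(1) I by blast
    then have "1 \<le> ?n" by (simp add: valid_inst_def)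
    define R where "R = M / m"
    have R: "1 \<le> R" using assms(5,6) by (simp add: R_def)
    have q_ge: "R / (\<epsilon> + R) \<le> q" and "q \<le> 1"
      using q(2) by (simp_all add: R_def)
    have "0 < R / (\<epsilon> + R)" using R assms(7) by simp
    with q_ge have "0 < q" by simp
    \<comment> \<open>From \<open>1 \<le> R\<close> it follows that even the smallest admissible
      ratio \<open>q\<close> satisfies \<open>1 \<le> (1 + \<epsilon>) * q\<close>.\<close>
    have "\<epsilon> * 1 \<le> \<epsilon> * R"
      using R assms(7) by (intro mult_left_mono) simp_all
    then have "\<epsilon> + R \<le> (1 + \<epsilon>) * R" unfolding distrib_right by simp
    then have "1 \<le> (1 + \<epsilon>) * (R / (\<epsilon> + R))"
      using R assms(7) by (simp add: pos_le_divide_eq)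
    also have "\<dots> \<le> (1 + \<epsilon>) * q"
      using q_ge assms(7) by (intro mult_left_mono) simp_all
    finally have "1 \<le> (1 + \<epsilon>) * q" .
    \<comment> \<open>Positivity of \<open>q\<close> makes the selection nonempty, and
      \<open>q \<le> 1\<close> ensures that \<open>n\<close> candidates suffice.\<close>
    have k: "0 < k" "k \<le> ?n"
    proof -
      have "0 < real k"
        unfolding q(1) using \<open>0 < q\<close> \<open>1 \<le> ?n\<close> by simp
      moreover have "real k \<le> 1 * real ?n"
        unfolding q(1) using \<open>q \<le> 1\<close> by (intro mult_right_mono) simp_all
      ultimately show "0 < k" "k \<le> ?n" by auto
    qed
    obtain xs t1 where xs: "xs \<in> m3_feasible I ?n" "m3_value I xs = m3_opt I ?n"
      and run1: "runs orc solve (Node (Atom (int ?n)) (desc I)) (enc_list enc_vec xs) t1"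
      and t1: "t1 \<le> poly p1 ?n"
      using solve[OF I orc] by blast
    have xs_len: "length xs = ?n" and xs_feas: "set xs \<subseteq> feas I"
      using xs(1) by (auto simp: m3_feasible_def)
    obtain l t2 where l: "l \<in> optimal_weights I xs" "rat_vec l"
      and run2: "runs orc weigh (Node (Atom (int ?n)) (Node (enc_list enc_vec xs) (desc I))) (enc_vec l) t2"
      and t2: "t2 \<le> poly p2 ?n"
      using weigh[OF I xs_len xs_feas] by blast
    have "dim_vec l = ?n"
      using l(1) xs_len by (auto simp: optimal_weights_def weight_simplex_def)
    then obtain rs where rs: "enc_vec l = enc_list enc_rat rs" "length rs = ?n"
        "\<forall>i<?n. l $ i = of_rat (rs ! i)"
      using enc_vec_rat[OF l(2)] by metis
    obtain sel rem t where
      run: "runs orc (approx_prog solve weigh) (Node (Atom (int ?n)) (Node (Atom (int k)) (desc I)))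
        (enc_fsts enc_vec sel) t"
      and sel: "mset sel + mset rem = mset (zip xs rs)" "length sel = k"
        "\<forall>a\<in>set sel. \<forall>b\<in>set rem. snd b \<le> snd a"
      and t: "t \<le> t1 + t2 + 40 + ?n * (50 + t1 + ?n * (41 + 4 * t2))"
      using approx_prog_runs[OF run1 run2[unfolded rs(1)] xs_len rs(2) k(2)] .
    have "fst a \<in> set xs" if "a \<in> set sel" for a
      using fst_selected[OF sel(1) that] .
    then have feasible: "map fst sel \<in> m3_feasible I k"
      using xs_feas sel(2) by (auto simp: m3_feasible_def)
    have "real k * m3_value I (map fst sel) \<le> real ?n * m3_opt I k"
      using m3_value_selection[OF valid refl xs l(1) rs(2,3) sel(1,3,2) k(1)] .
    \<comment> \<open>Substituting \<open>k = q * n\<close> lets the dimension cancel.\<close>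
    then have "real ?n * (q * m3_value I (map fst sel)) \<le> real ?n * m3_opt I k"
      by (simp add: q(1) mult.commute mult.left_commute)
    then have le_opt: "q * m3_value I (map fst sel) \<le> m3_opt I k"
      using \<open>1 \<le> ?n\<close> by simp
    have "0 \<le> m3_value I (map fst sel)"
      using m3_value_nonneg[OF valid, of "map fst sel"] feasible k(1) by (auto simp: m3_feasible_def)
    then have "1 * m3_value I (map fst sel) \<le> (1 + \<epsilon>) * q * m3_value I (map fst sel)"
      using \<open>1 \<le> (1 + \<epsilon>) * q\<close> by (intro mult_right_mono)
    also have "\<dots> \<le> (1 + \<epsilon>) * m3_opt I k"
      using le_opt assms(7) by (simp add: mult.assoc)
    finally have "m3_value I (map fst sel) \<le> (1 + \<epsilon>) * m3_opt I k" by simp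
    moreover have "t \<le> poly p ?n"
    proof -
      have "t1 + t2 + 40 + ?n * (50 + t1 + ?n * (41 + 4 * t2)) \<le> poly p ?n"
        unfolding poly_p by (intro add_mono mult_mono t1 t2) simp_all
      with t show ?thesis by simp
    qed
    moreover have "enc_fsts enc_vec sel = enc_list enc_vec (map fst sel)"
      by (simp add: enc_list_map)
    ultimately show ?thesis using run feasible by (intro exI[of _ "enc_fsts enc_vec sel"] exI[of _ t]) simp
  qed
  show ?thesis
  proof (rule solvable_in_oracle_poly_timeI)
    fix N v Orc Out orc
    assume "(N, v, Orc, Out) \<in> m3_approx_problem (1 + \<epsilon>) {(I, k). I \<in> \<C> \<and>
      (\<exists>q :: real. real k = q * real (inst_dim I) \<and> q \<in> {(M / m) / (\<epsilon> + M / m)..1})}"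
    then obtain I k q where "I \<in> \<C>"
      and "real k = q * real (inst_dim I)" "q \<in> {(M / m) / (\<epsilon> + M / m)..1}"
      and eq: "N = inst_dim I" "v = Node (Atom (int (inst_dim I))) (Node (Atom (int k)) (desc I))"
        "Orc = opt_oracles I"
        "Out = enc_list enc_vec ` {xs \<in> m3_feasible I k. m3_value I xs \<le> (1 + \<epsilon>) * m3_opt I k}"
      unfolding m3_approx_problem_def by blast
    moreover assume "orc \<in> Orc"
    ultimately show "\<exists>w t. runs orc (approx_prog solve weigh) v w t \<and> w \<in> Out \<and> t \<le> poly p N"
      using approx unfolding eq by simp
  qed
qed

end
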